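(* Let $n\ge 3$ be an integer and let $0<x_1\le x_2\le\dots\le x_n$ be positive integers with $\sigma_{n-2}(x_1,\dots,x_n)=\sigma_n(x_1,\dots,x_n)$. Then for every integer $k$ with $0\le k\le n-1$, $$x_{n-k}\le 2(k+1)v_{n-k}.$$
   Context: For $1\le j\le n$, $\sigma_j(x_1,\dots,x_n)=\sum_{1\le i_1<\dots<i_j\le n}x_{i_1}\cdots x_{i_j}$ is the $j$th elementary symmetric polynomial. The sequence $(v_n)_{n\ge1}$ is defined recursively by $v_1=1$, $v_2=2$, and for $n\ge 2$ $$v_{n+1}=1+\frac{\sum_{1\le i\le n}\frac{1}{v_i}}{1-\sum_{1\le i<j\le n}\frac{1}{v_iv_j}}.$$ Its first terms are $1,2,4,15,219,47863,\dots$; it is an increasing sequence of positive integers. *)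

theory Defs
  imports Complex_Main
begin

definition esym :: "nat \<Rightarrow> nat \<Rightarrow> (nat \<Rightarrow> 'a::comm_semiring_1) \<Rightarrow> 'a" where
  "esym j n x = (\<Sum>S | S \<subseteq> {1..n} \<and> card S = j. \<Prod>i\<in>S. x i)"

text \<open>
  The sequence is indexed from 1; the value at 0 is a dummy. The last equation is the recursion
  for \<open>v\<^sub>m\<^sub>+\<^sub>1\<close> with \<open>m = n + 2 \<ge> 2\<close>, the sum over pairs \<open>1 \<le> i < j \<le> m\<close> being written as an
  iterated sum.
\<close>

fun vseq :: "nat \<Rightarrow> real" where
  "vseq 0 = 0"
| "vseq (Suc 0) = 1"
| "vseq (Suc (Suc 0)) = 2"
| "vseq (Suc (Suc (Suc n))) =
     1 + (\<Sum>i\<in>{1..n + 2}. 1 / vseq i)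
         / (1 - (\<Sum>j\<in>{1..n + 2}. \<Sum>i\<in>{1..<j}. 1 / (vseq i * vseq j)))"

lemma vseq_rec:
  assumes "n \<ge> 2"
  shows "vseq (n + 1) = 1 + (\<Sum>i\<in>{1..n}. 1 / vseq i)
           / (1 - (\<Sum>(i, j) | 1 \<le> i \<and> i < j \<and> j \<le> n. 1 / (vseq i * vseq j)))"
proof -
  obtain m where m: "n = m + 2"
    using assms by (metis add.commute le_Suc_ex)
  have "(\<Sum>j\<in>{1..n}. \<Sum>i\<in>{1..<j}. 1 / (vseq i * vseq j))
      = (\<Sum>(j, i)\<in>(SIGMA j:{1..n}. {1..<j}). 1 / (vseq i * vseq j))"
    by (simp add: sum.Sigma)
  also have "\<dots> = (\<Sum>(i, j) | 1 \<le> i \<and> i < j \<and> j \<le> n. 1 / (vseq i * vseq j))"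
    by (rule sum.reindex_bij_witness[where i = prod.swap and j = prod.swap]) auto
  finally show ?thesis
    by (simp add: m)
qed

end

theory Submission
  imports Defs
begin

text \<open>
  Put \<open>y\<^sub>i = 1 / x\<^sub>i\<close>, so that the hypothesis becomes \<open>e\<^sub>2(y\<^sub>1, \<dots>, y\<^sub>n) = 1\<close>. For the reciprocals
  \<open>w\<^sub>i = 1 / v\<^sub>i\<close> one has \<open>1 - e\<^sub>2(w\<^sub>1, \<dots>, w\<^sub>m) = 1 / (v\<^sub>1 \<cdots> v\<^sub>m)\<close>, the smallest gap that integrality
  permits for a given product. The key is that, among nondecreasing positive integers with
  \<open>e\<^sub>2(y\<^sub>1, \<dots>, y\<^sub>m) < 1\<close>, both \<open>e\<^sub>1\<close> and \<open>e\<^sub>2\<close> are maximal for the sequence \<open>v\<close>.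

  For \<open>e\<^sub>2\<close> this is proved by strong induction on \<open>m\<close>. If \<open>x\<^sub>1 \<cdots> x\<^sub>m \<le> v\<^sub>1 \<cdots> v\<^sub>m\<close>, integrality suffices.
  Otherwise cut at the index \<open>k < m\<close> minimising \<open>(x\<^sub>1 \<cdots> x\<^sub>k) / (v\<^sub>1 \<cdots> v\<^sub>k)\<close>: the tails after \<open>k\<close> are
  then ordered by multiplicative majorization, and the prefixes by induction.

  The bound for \<open>e\<^sub>1\<close> follows from that for \<open>e\<^sub>2\<close> through \<open>e\<^sub>1\<^sup>2 = 2 e\<^sub>2 + \<Sum> y\<^sub>i\<^sup>2\<close>: at the first index
  where \<open>x\<close> leaves \<open>v\<close> it exceeds \<open>v\<close>, which makes the sum of squares smaller
  as soon as that entry of \<open>v\<close> is at least 4; the first two indices are estimated directly.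

  Finally, with \<open>m = n - k - 1\<close>, the tail sum \<open>T = y\<^sub>m\<^sub>+\<^sub>1 + \<dots> + y\<^sub>n \<le> (k + 1) / x\<^sub>m\<^sub>+\<^sub>1\<close> satisfies
  \<open>1 - e\<^sub>2 \<le> e\<^sub>1 T + T\<^sup>2 / 2\<close>, where \<open>e\<^sub>1 \<le> (1 - e\<^sub>2) v\<^sub>m\<^sub>+\<^sub>1\<close> by the key fact. This is impossible when
  \<open>T < 1 / (2 v\<^sub>m\<^sub>+\<^sub>1)\<close>.
\<close>

section \<open>First and second elementary symmetric sums of a real sequence\<close>

primrec e1 :: "(nat \<Rightarrow> real) \<Rightarrow> nat \<Rightarrow> real" where
  "e1 y 0 = 0"
| "e1 y (Suc n) = e1 y n + y (Suc n)"

primrec e2 :: "(nat \<Rightarrow> real) \<Rightarrow> nat \<Rightarrow> real" where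
  "e2 y 0 = 0"
| "e2 y (Suc n) = e2 y n + y (Suc n) * e1 y n"

lemma e1_eq_sum: "e1 y n = (\<Sum>i\<in>{1..n}. y i)"
  by (induction n) simp_all

lemma e2_eq_sum: "e2 y n = (\<Sum>j\<in>{1..n}. \<Sum>i\<in>{1..<j}. y i * y j)"
  by (induction n)
    (simp_all add: e1_eq_sum sum_distrib_left mult.commute atLeastLessThanSuc_atLeastAtMost)

lemma e1_nonneg: "(\<And>i. 1 \<le> i \<Longrightarrow> i \<le> n \<Longrightarrow> 0 \<le> y i) \<Longrightarrow> 0 \<le> e1 y n"
  by (induction n) auto

lemma e2_nonneg: "(\<And>i. 1 \<le> i \<Longrightarrow> i \<le> n \<Longrightarrow> 0 \<le> y i) \<Longrightarrow> 0 \<le> e2 y n"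
  by (induction n) (auto intro!: add_nonneg_nonneg mult_nonneg_nonneg e1_nonneg)

lemma e1_cong: "(\<And>i. 1 \<le> i \<Longrightarrow> i \<le> n \<Longrightarrow> y i = z i) \<Longrightarrow> e1 y n = e1 z n"
  by (induction n) auto

lemma e2_cong: "(\<And>i. 1 \<le> i \<Longrightarrow> i \<le> n \<Longrightarrow> y i = z i) \<Longrightarrow> e2 y n = e2 z n"
  by (induction n) (auto intro!: e1_cong)

lemma e1_add: "e1 y (k + n) = e1 y k + e1 (\<lambda>i. y (k + i)) n"
  by (induction n) auto

text \<open>A pair of indices lies before the cut at \<open>k\<close>, across it, or after it. This
  is how prefixes and tails are separated throughout.\<close>

lemma e2_add:
  "e2 y (k + n) = e2 y k + e1 y k * e1 (\<lambda>i. y (k + i)) n + e2 (\<lambda>i. y (k + i)) n"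
proof (induction n)
  case (Suc n)
  then show ?case using e1_add[of y k n] by (simp add: distrib_left mult.commute)
qed simp

lemma e1_square: "(e1 y n)\<^sup>2 = 2 * e2 y n + e1 (\<lambda>i. (y i)\<^sup>2) n"
  by (induction n) (auto simp: power2_eq_square algebra_simps)

lemma e1_le_mult:
  "(\<And>i. 1 \<le> i \<Longrightarrow> i \<le> n \<Longrightarrow> y i \<le> b) \<Longrightarrow> e1 y n \<le> real n * b"
proof (induction n)
  case (Suc n)
  have "e1 y n \<le> real n * b" "y (Suc n) \<le> b" using Suc by auto
  then show ?case by (simp add: algebra_simps)
qed simp

lemma e1_sq_le_mult:
  assumes "\<And>i. 1 \<le> i \<Longrightarrow> i \<le> n \<Longrightarrow> 0 \<le> y i \<and> y i \<le> b"
  shows "e1 (\<lambda>i. (y i)\<^sup>2) n \<le> b * e1 y n"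
  using assms
proof (induction n)
  case (Suc n)
  have "e1 (\<lambda>i. (y i)\<^sup>2) n \<le> b * e1 y n" using Suc by auto
  moreover have "(y (Suc n))\<^sup>2 \<le> b * y (Suc n)"
    using Suc.prems[of "Suc n"] by (auto simp: power2_eq_square intro!: mult_right_mono)
  ultimately show ?case by (simp add: algebra_simps)
qed simp

lemma e1_sq_le_square:
  assumes "\<And>i. 1 \<le> i \<Longrightarrow> i \<le> n \<Longrightarrow> 0 \<le> y i"
  shows "e1 (\<lambda>i. (y i)\<^sup>2) n \<le> (e1 y n)\<^sup>2"
  using e1_square[of y n] e2_nonneg[of n y] assms by simp

lemma e1_mono_length:
  assumes "\<And>i. m < i \<Longrightarrow> i \<le> n \<Longrightarrow> 0 \<le> y i" "m \<le> n"
  shows "e1 y m \<le> e1 y n"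
proof -
  have "0 \<le> e1 (\<lambda>i. y (m + i)) (n - m)"
    by (rule e1_nonneg) (use assms in auto)
  then show ?thesis using e1_add[of y m "n - m"] assms(2) by simp
qed

lemma e1_pos:
  assumes "\<And>i. 1 \<le> i \<Longrightarrow> i \<le> n \<Longrightarrow> 0 < y i" "0 < n"
  shows "0 < e1 y n"
proof -
  have "e1 y 1 \<le> e1 y n"
    by (rule e1_mono_length) (use assms in \<open>auto simp: less_imp_le\<close>)
  then show ?thesis using assms(1)[of 1] assms(2) by simp
qed

section \<open>Abel summation, tangent inequalities and majorization\<close>

text \<open>The induction carries more: each partial sum of \<open>a i * l i\<close> is at least
  \<open>a j * e1 l j\<close>. Replacing the weight \<open>a j\<close> by the smaller
  \<open>a (Suc j)\<close> only lowers this bound, because \<open>e1 l j\<close> is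
  nonnegative.\<close>

lemma abel_nonneg:
  fixes a l :: "nat \<Rightarrow> real"
  assumes "\<And>i. 1 \<le> i \<Longrightarrow> i \<le> n \<Longrightarrow> 0 \<le> a i"
    and "\<And>i. 1 \<le> i \<Longrightarrow> i < n \<Longrightarrow> a (Suc i) \<le> a i"
    and "\<And>j. j \<le> n \<Longrightarrow> 0 \<le> e1 l j"
  shows "0 \<le> e1 (\<lambda>i. a i * l i) n"
proof (cases n)
  case (Suc n')
  have "a j * e1 l j \<le> e1 (\<lambda>i. a i * l i) j" if "1 \<le> j" "j \<le> n" for j
    using that
  proof (induction j)
    case (Suc j)
    show ?case
    proof (cases "j = 0")
      case False
      have "a (Suc j) * e1 l j \<le> a j * e1 l j"
        using assms(2)[of j] assms(3)[of j] Suc.prems False by (intro mult_right_mono) auto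
      also have "\<dots> \<le> e1 (\<lambda>i. a i * l i) j" using Suc False by auto
      finally show ?thesis by (simp add: algebra_simps)
    qed simp
  qed simp
  from this[of n] show ?thesis
    using assms(1)[of n] assms(3)[of n] Suc
    by (smt (verit) le_refl mult_nonneg_nonneg Suc_le_mono One_nat_def zero_le)
qed simp

lemma mult_ln_le_diff:
  fixes a b :: real
  assumes "0 < a" "0 < b"
  shows "a * ln (b / a) \<le> b - a"
proof -
  have "ln (b / a) \<le> b / a - 1" using assms by (intro ln_le_minus_one) auto
  then have "a * ln (b / a) \<le> a * (b / a - 1)" using assms by (intro mult_left_mono) auto
  then show ?thesis using assms by (simp add: algebra_simps)
qed

lemma e1_tangent:
  assumes "\<And>i. 1 \<le> i \<Longrightarrow> i \<le> n \<Longrightarrow> 0 < y i \<and> 0 < w i"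
  shows "e1 (\<lambda>i. y i * ln (w i / y i)) n \<le> e1 w n - e1 y n"
  using assms
proof (induction n)
  case (Suc n)
  show ?case using Suc.IH Suc.prems mult_ln_le_diff[of "y (Suc n)" "w (Suc n)"] by force
qed simp

lemma e1_scale: "e1 (\<lambda>i. c * y i) n = c * e1 y n"
  by (induction n) (auto simp: algebra_simps)

lemma e1_plus: "e1 (\<lambda>i. y i + z i) n = e1 y n + e1 z n"
  by (induction n) auto

text \<open>
  Weighted by the products \<open>y\<^sub>i y\<^sub>j\<close>, the tangent inequality gives \<open>ln (w\<^sub>i / y\<^sub>i)\<close> the coefficient
  \<open>y\<^sub>i (e\<^sub>1 - y\<^sub>i)\<close>, which decreases along a decreasing \<open>y\<close>; hence Abel summation applies below.
\<close>

lemma e2_tangent: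
  assumes "\<And>i. 1 \<le> i \<Longrightarrow> i \<le> n \<Longrightarrow> 0 < y i \<and> 0 < w i"
  shows "e1 (\<lambda>i. y i * (e1 y n - y i) * ln (w i / y i)) n \<le> e2 w n - e2 y n"
  using assms
proof (induction n)
  case (Suc n)
  let ?a = "y (Suc n)" and ?b = "w (Suc n)"
  let ?l = "\<lambda>i. ln (w i / y i)"
  have pos: "0 < ?a" "0 < ?b" using Suc.prems[of "Suc n"] by auto
  \<comment> \<open>These terms are the pairs containing the new index: the tangent inequality is
    applied to the products \<open>?a * y i\<close> and \<open>?b * w i\<close>.\<close>
  have "e1 (\<lambda>i. (?a * y i) * ln ((?b * w i) / (?a * y i))) n
      \<le> e1 (\<lambda>i. ?b * w i) n - e1 (\<lambda>i. ?a * y i) n"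
    by (rule e1_tangent) (use Suc.prems pos in auto)
  also have "e1 (\<lambda>i. (?a * y i) * ln ((?b * w i) / (?a * y i))) n
      = e1 (\<lambda>i. ?a * (y i * ?l i) + (?a * ?l (Suc n)) * y i) n"
  proof (rule e1_cong)
    fix i assume "1 \<le> i" "i \<le> n"
    then have "0 < y i" "0 < w i" using Suc.prems[of i] by auto
    then have "ln ((?b * w i) / (?a * y i)) = ?l i + ?l (Suc n)"
      using pos by (simp add: ln_div ln_mult)
    then show "(?a * y i) * ln ((?b * w i) / (?a * y i))
        = ?a * (y i * ?l i) + (?a * ?l (Suc n)) * y i"
      by (simp add: algebra_simps)
  qed
  finally have 1: "?a * e1 (\<lambda>i. y i * ?l i) n + ?a * ?l (Suc n) * e1 y n
      \<le> ?b * e1 w n - ?a * e1 y n"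
    by (simp only: e1_plus e1_scale)
  \<comment> \<open>Passing from \<open>e1 y n\<close> to \<open>e1 y (Suc n)\<close> in the weights
    adds exactly the first sum on the left of fact 1.\<close>
  have "e1 (\<lambda>i. y i * (e1 y (Suc n) - y i) * ?l i) n
      = e1 (\<lambda>i. y i * (e1 y n - y i) * ?l i + ?a * (y i * ?l i)) n"
    by (rule e1_cong) (simp add: algebra_simps)
  also have "\<dots> = e1 (\<lambda>i. y i * (e1 y n - y i) * ?l i) n + ?a * e1 (\<lambda>i. y i * ?l i) n"
    by (simp only: e1_plus e1_scale)
  finally have 2: "e1 (\<lambda>i. y i * (e1 y (Suc n) - y i) * ?l i) n = \<dots>" .
  have 3: "e1 (\<lambda>i. y i * (e1 y n - y i) * ?l i) n \<le> e2 w n - e2 y n"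
    using Suc by auto
  have "e1 (\<lambda>i. y i * (e1 y (Suc n) - y i) * ?l i) (Suc n)
      = e1 (\<lambda>i. y i * (e1 y (Suc n) - y i) * ?l i) n + ?a * ?l (Suc n) * e1 y n"
    by simp
  then show ?case using 1 2 3 by (simp add: mult_ac)
qed simp

lemma e1_ge_member:
  assumes "\<And>i. 1 \<le> i \<Longrightarrow> i \<le> n \<Longrightarrow> 0 \<le> y i" "1 \<le> i" "i < n"
  shows "y i + y (Suc i) \<le> e1 y n"
proof -
  have "e1 y (Suc i) \<le> e1 y n" by (rule e1_mono_length) (use assms in auto)
  moreover have "e1 y (Suc i) = e1 y (i - 1) + y i + y (Suc i)"
    using assms(2) by (cases i) auto
  moreover have "0 \<le> e1 y (i - 1)" by (rule e1_nonneg) (use assms in auto)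
  ultimately show ?thesis by simp
qed

text \<open>The assumption \<open>ln\<close> is majorization of prefix products in logarithmic form.
  The tangent inequalities give \<open>ln (w i / y i)\<close> the weight \<open>?a i\<close>, and
  \<open>?a i - ?a (Suc i)\<close> factors as
  \<open>(y i - y (Suc i)) * (s + e1 y n - y i - y (Suc i))\<close>, so Abel summation applies. In
  the application \<open>s\<close> is the sum of a preceding prefix.\<close>

lemma e1_e2_majorization:
  assumes pos: "\<And>i. 1 \<le> i \<Longrightarrow> i \<le> n \<Longrightarrow> 0 < y i \<and> 0 < w i"
    and dec: "\<And>i. 1 \<le> i \<Longrightarrow> i < n \<Longrightarrow> y (Suc i) \<le> y i"
    and ln: "\<And>j. j \<le> n \<Longrightarrow> 0 \<le> e1 (\<lambda>i. ln (w i / y i)) j"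
    and s: "0 \<le> s"
  shows "s * e1 y n + e2 y n \<le> s * e1 w n + e2 w n"
proof -
  let ?l = "\<lambda>i. ln (w i / y i)"
  let ?a = "\<lambda>i. s * y i + y i * (e1 y n - y i)"
  have le: "y i \<le> e1 y n" if "1 \<le> i" "i \<le> n" for i
  proof -
    have "e1 y i \<le> e1 y n"
      by (rule e1_mono_length) (use that pos in \<open>auto simp: less_imp_le\<close>)
    moreover have "0 \<le> e1 y (i - 1)"
      by (rule e1_nonneg) (use that pos in \<open>auto simp: less_imp_le\<close>)
    moreover have "e1 y i = e1 y (i - 1) + y i" using that(1) by (cases i) auto
    ultimately show ?thesis by simp
  qed
  have "0 \<le> e1 (\<lambda>i. ?a i * ?l i) n"
  proof (rule abel_nonneg)
    show "0 \<le> ?a i" if "1 \<le> i" "i \<le> n" for i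
      using le[OF that] pos[OF that] s by auto
    show "?a (Suc i) \<le> ?a i" if i: "1 \<le> i" "i < n" for i
    proof -
      have "y i + y (Suc i) \<le> e1 y n"
        by (rule e1_ge_member) (use i pos in \<open>auto simp: less_imp_le\<close>)
      then have "0 \<le> (y i - y (Suc i)) * (s + (e1 y n - y i - y (Suc i)))"
        using dec[OF i] s by (intro mult_nonneg_nonneg) auto
      then show ?thesis by (simp add: algebra_simps)
    qed
  qed (use ln in auto)
  also have "e1 (\<lambda>i. ?a i * ?l i) n
      = e1 (\<lambda>i. s * (y i * ?l i) + y i * (e1 y n - y i) * ?l i) n"
    by (rule e1_cong) (simp add: algebra_simps)
  also have "\<dots> = s * e1 (\<lambda>i. y i * ?l i) n + e1 (\<lambda>i. y i * (e1 y n - y i) * ?l i) n"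
    by (simp only: e1_plus e1_scale)
  also have "\<dots> \<le> s * (e1 w n - e1 y n) + (e2 w n - e2 y n)"
    by (intro add_mono mult_left_mono e1_tangent e2_tangent) (use pos s in auto)
  finally show ?thesis by (simp add: algebra_simps)
qed

section \<open>Reciprocals, integrality and the sequence \<open>vseq\<close>\<close>

definition recip :: "(nat \<Rightarrow> real) \<Rightarrow> nat \<Rightarrow> real" where
  "recip x i = 1 / x i"

abbreviation pr :: "(nat \<Rightarrow> real) \<Rightarrow> nat \<Rightarrow> real" where
  "pr x n \<equiv> \<Prod>i\<in>{1..n}. x i"

text \<open>With denominators cleared, the two sums are the elementary symmetric polynomials in
  \<open>x\<close> of degrees \<open>n - 1\<close> and \<open>n - 2\<close>. These recurrences yield
  their integrality and later their agreement with \<open>esym\<close>.\<close>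

lemma pr_e_Suc:
  assumes "x (Suc n) \<noteq> 0"
  shows "pr x (Suc n) * e1 (recip x) (Suc n) = x (Suc n) * (pr x n * e1 (recip x) n) + pr x n"
    and "pr x (Suc n) * e2 (recip x) (Suc n)
      = x (Suc n) * (pr x n * e2 (recip x) n) + pr x n * e1 (recip x) n"
  using assms by (simp_all add: recip_def field_simps)

lemma vseq_Suc_e: "n \<ge> 2 \<Longrightarrow>
  vseq (Suc n) = 1 + e1 (recip vseq) n / (1 - e2 (recip vseq) n)"
  by (auto simp: e1_eq_sum e2_eq_sum recip_def numeral_2_eq_2 dest!: le_Suc_ex)

text \<open>The three claims feed each other. The product form of \<open>vseq (Suc n)\<close> makes
  the cleared gap telescope to 1, and a cleared gap of 1 turns the quotient in the next recursion
  step back into a product.\<close>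

lemma vseq_invariant:
  "(\<forall>i\<in>{1..n}. 1 \<le> vseq i)
    \<and> pr vseq n * (1 - e2 (recip vseq) n) = 1
    \<and> vseq (Suc n) = 1 + e1 (recip vseq) n * pr vseq n"
proof (induction n)
  case (Suc n)
  let ?w = "recip vseq"
  from Suc have IH: "\<And>i. i \<in> {1..n} \<Longrightarrow> 1 \<le> vseq i"
    "pr vseq n * (1 - e2 ?w n) = 1" "vseq (Suc n) = 1 + e1 ?w n * pr vseq n"
    by auto
  have P: "0 < pr vseq n" by (rule prod_pos) (use IH(1) in force)
  have S: "0 \<le> e1 ?w n"
    by (rule e1_nonneg) (use IH(1) in \<open>force simp: recip_def\<close>)
  have v: "1 \<le> vseq (Suc n)" using IH(3) P S by simp
  have 1: "\<forall>i\<in>{1..Suc n}. 1 \<le> vseq i"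
    using IH(1) v by (auto simp: le_Suc_eq)
  have "pr vseq (Suc n) * (1 - e2 ?w (Suc n))
      = vseq (Suc n) * (pr vseq n * (1 - e2 ?w n)) - e1 ?w n * pr vseq n"
    using v by (simp add: recip_def field_simps)
  also have "\<dots> = 1" using IH by simp
  finally have 2: "pr vseq (Suc n) * (1 - e2 ?w (Suc n)) = 1" .
  have "vseq (Suc (Suc n)) = 1 + e1 ?w (Suc n) * pr vseq (Suc n)"
  \<comment> \<open>The value at index 2 is an initial value, not an instance of the
    recursion.\<close>
  proof (cases "n = 0")
    case False
    have "1 - e2 ?w (Suc n) = 1 / pr vseq (Suc n)"
      using 2 by (metis nonzero_mult_div_cancel_left mult_zero_left zero_neq_one)
    then show ?thesis using vseq_Suc_e[of "Suc n"] False by simp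
  qed (simp add: recip_def)
  then show ?case using 1 2 by blast
qed simp

lemma vseq_ge_1: "1 \<le> i \<Longrightarrow> 1 \<le> vseq i"
  using vseq_invariant[of i] by auto

lemma vseq_Suc: "vseq (Suc n) = 1 + e1 (recip vseq) n * pr vseq n"
  using vseq_invariant by blast

lemma vseq_pr_pos: "0 < pr vseq n"
  by (rule prod_pos) (use vseq_ge_1 in force)

lemma e2_vseq: "1 - e2 (recip vseq) n = 1 / pr vseq n"
  using vseq_invariant[of n]
  by (metis nonzero_mult_div_cancel_left mult_zero_left zero_neq_one)

lemma recip_vseq_pos: "1 \<le> i \<Longrightarrow> 0 < recip vseq i"
  using vseq_ge_1[of i] by (simp add: recip_def)

lemma e_Ints:
  assumes "\<And>i. 1 \<le> i \<Longrightarrow> i \<le> n \<Longrightarrow> x i \<in> \<int> \<and> 0 < x i"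
  shows "pr x n \<in> \<int> \<and> e1 (recip x) n * pr x n \<in> \<int> \<and> e2 (recip x) n * pr x n \<in> \<int>"
  using assms
proof (induction n)
  case (Suc n)
  have x: "x (Suc n) \<in> \<int>" "0 < x (Suc n)" using Suc.prems[of "Suc n"] by auto
  have IH: "pr x n \<in> \<int>" "e1 (recip x) n * pr x n \<in> \<int>" "e2 (recip x) n * pr x n \<in> \<int>"
    using Suc by auto
  have "e1 (recip x) (Suc n) * pr x (Suc n)
      = x (Suc n) * (e1 (recip x) n * pr x n) + pr x n"
    using x pr_e_Suc(1)[of x n] by (simp only: mult.commute)
  moreover have "e2 (recip x) (Suc n) * pr x (Suc n)
      = x (Suc n) * (e2 (recip x) n * pr x n) + e1 (recip x) n * pr x n"
    using x pr_e_Suc(2)[of x n] by (simp only: mult.commute)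
  ultimately show ?case using IH x by (auto simp: mult.commute)
qed simp

lemma vseq_Ints: "vseq n \<in> \<int>"
proof (induction n rule: less_induct)
  case (less n)
  show ?case
  proof (cases n)
    case (Suc m)
    have "e1 (recip vseq) m * pr vseq m \<in> \<int>"
      using e_Ints[of m vseq] less Suc vseq_ge_1 by (smt (verit) le_imp_less_Suc)
    then show ?thesis using Suc by (simp add: vseq_Suc del: vseq.simps)
  qed simp
qed

lemma Ints_gap:
  fixes a b :: real
  assumes "a \<in> \<int>" "b \<in> \<int>" "a < b"
  shows "a + 1 \<le> b"
  using assms by (auto elim!: Ints_cases)

text \<open>Multiplied by \<open>pr x n\<close>, the sum becomes an integer below the integer
  \<open>pr x n\<close>, hence smaller by at least 1. By \<open>e2_vseq\<close> the sequence
  \<open>vseq\<close> attains equality.\<close>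

lemma e2_gap:
  assumes "\<And>i. 1 \<le> i \<Longrightarrow> i \<le> n \<Longrightarrow> x i \<in> \<int> \<and> 0 < x i"
    and "e2 (recip x) n < 1"
  shows "e2 (recip x) n \<le> 1 - 1 / pr x n"
proof -
  have P: "0 < pr x n" by (rule prod_pos) (use assms in auto)
  have "e2 (recip x) n * pr x n < pr x n" using P assms(2) by simp
  then have "e2 (recip x) n * pr x n + 1 \<le> pr x n"
    using e_Ints[of n x] assms(1) by (intro Ints_gap) auto
  moreover have "e \<le> 1 - 1 / p" if "0 < p" "e * p + 1 \<le> p" for e p :: real
    using that by (simp add: field_simps)
  ultimately show ?thesis using P by blast
qed

lemma vseq_mono_Suc:
  assumes "1 \<le> n"
  shows "vseq n \<le> vseq (Suc n)"
proof -
  from assms obtain m where m: "n = Suc m" by (cases n) auto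
  have a: "1 \<le> pr vseq m" by (rule prod_ge_1) (use vseq_ge_1 in auto)
  have b: "0 \<le> e1 (recip vseq) m"
    by (rule e1_nonneg) (use recip_vseq_pos in \<open>auto simp: less_imp_le\<close>)
  have c: "1 \<le> vseq (Suc m)" by (rule vseq_ge_1) simp
  have "e1 (recip vseq) (Suc m) * pr vseq (Suc m)
      = vseq (Suc m) * (e1 (recip vseq) m * pr vseq m) + pr vseq m"
    using c by (simp add: recip_def field_simps del: vseq.simps)
  moreover have "1 * (e1 (recip vseq) m * pr vseq m) \<le> vseq (Suc m) * (e1 (recip vseq) m * pr vseq m)"
    by (rule mult_right_mono) (use a b c in auto)
  ultimately show ?thesis using a m by (simp add: vseq_Suc del: vseq.simps)
qed

lemma vseq_values: "vseq 3 = 4" "vseq 4 = 15"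
  by (simp_all add: numeral_eq_Suc vseq_Suc recip_def del: vseq.simps(4))

lemma vseq_ge_4: "3 \<le> n \<Longrightarrow> 4 \<le> vseq n"
proof (induction n rule: dec_induct)
  case (step n)
  then show ?case using vseq_mono_Suc[of n] by simp
qed (simp add: vseq_values)


section \<open>Nondecreasing positive integers and the bound on \<open>e1\<close>\<close>

locale sorted_ints =
  fixes x :: "nat \<Rightarrow> real" and n :: nat
  assumes int_pos: "\<And>i. 1 \<le> i \<Longrightarrow> i \<le> n \<Longrightarrow> x i \<in> \<int> \<and> 0 < x i"
    and mono: "\<And>i j. 1 \<le> i \<Longrightarrow> i \<le> j \<Longrightarrow> j \<le> n \<Longrightarrow> x i \<le> x j"
begin

lemma ge_1: "1 \<le> i \<Longrightarrow> i \<le> n \<Longrightarrow> 1 \<le> x i"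
  using int_pos[of i] Ints_gap[of 0 "x i"] by simp

lemma recip_pos: "1 \<le> i \<Longrightarrow> i \<le> n \<Longrightarrow> 0 < recip x i"
  using int_pos by (simp add: recip_def)

lemma recip_mono: "1 \<le> i \<Longrightarrow> i \<le> j \<Longrightarrow> j \<le> n \<Longrightarrow> recip x j \<le> recip x i"
  using int_pos[of i] mono[of i j] by (simp add: recip_def frac_le)

lemma pr_pos: "m \<le> n \<Longrightarrow> 0 < pr x m"
  by (rule prod_pos) (use int_pos in auto)

lemma e2_prefix_le:
  assumes m: "m \<le> n"
  shows "e2 (recip x) m \<le> e2 (recip x) n"
proof -
  have "0 \<le> e1 (recip x) m * e1 (\<lambda>i. recip x (m + i)) (n - m)"
    by (intro mult_nonneg_nonneg e1_nonneg) (use recip_pos m in \<open>auto simp: less_imp_le\<close>)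
  moreover have "0 \<le> e2 (\<lambda>i. recip x (m + i)) (n - m)"
    by (intro e2_nonneg) (use recip_pos m in \<open>auto simp: less_imp_le\<close>)
  ultimately show ?thesis using e2_add[of "recip x" m "n - m"] m by simp
qed

lemma prefix: "m \<le> n \<Longrightarrow> sorted_ints x m"
  by unfold_locales (use int_pos mono in auto)

end

text \<open>Here \<open>z\<close> is the tail of reciprocals from the first entry \<open>a\<close>
  that differs from the entry \<open>v\<close> of \<open>vseq\<close>. If \<open>a\<close> is at
  least \<open>v + 2\<close>, then \<open>z 1 * e1 z n\<close> suffices as a bound. If
  \<open>a = v + 1\<close>, the sum after the first term is at most
  \<open>2 / ((v - 1) * (v + 1))\<close>, and its square bounds the remaining squares.\<close>

lemma tail_squares_le:
  fixes z :: "nat \<Rightarrow> real"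
  assumes v: "4 \<le> v" "v \<in> \<int>"
    and z: "\<And>i. 1 \<le> i \<Longrightarrow> i \<le> n \<Longrightarrow> 0 \<le> z i \<and> z i \<le> z 1"
    and n: "1 \<le> n"
    and z1: "z 1 = 1 / a" "a \<in> \<int>" "v < a"
    and t: "e1 z n \<le> 1 / (v - 1)"
  shows "e1 (\<lambda>i. (z i)\<^sup>2) n \<le> 1 / v\<^sup>2"
proof (cases "a = v + 1")
  case False
  have "v + 1 \<le> a" using v z1 by (intro Ints_gap) auto
  then have "v + 1 + 1 \<le> a" using v z1 False by (intro Ints_gap) auto
  then have a: "z 1 \<le> 1 / (v + 2)" using z1 v by (simp add: frac_le)
  have "e1 (\<lambda>i. (z i)\<^sup>2) n \<le> z 1 * e1 z n" by (rule e1_sq_le_mult) (use z in auto)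
  also have "\<dots> \<le> (1 / (v + 2)) * (1 / (v - 1))"
    by (intro mult_mono a t e1_nonneg) (use z v in auto)
  also have "\<dots> = 1 / ((v + 2) * (v - 1))" by simp
  also have "\<dots> \<le> 1 / v\<^sup>2"
    by (rule frac_le) (use v in \<open>auto simp: power2_eq_square algebra_simps\<close>)
  finally show ?thesis .
next
  case True
  have split: "e1 y n = y 1 + e1 (\<lambda>i. y (1 + i)) (n - 1)" for y
    using e1_add[of y 1 "n - 1"] n by simp
  let ?r = "e1 (\<lambda>i. z (1 + i)) (n - 1)"
  have r0: "0 \<le> ?r" by (rule e1_nonneg) (use z in auto)
  have "?r \<le> 1 / (v - 1) - 1 / (v + 1)" using t split[of z] z1 True by simp
  also have "\<dots> = 2 / ((v - 1) * (v + 1))" using v by (simp add: divide_simps)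
  finally have "?r\<^sup>2 \<le> (2 / ((v - 1) * (v + 1)))\<^sup>2" using r0 by (intro power_mono) auto
  moreover have "e1 (\<lambda>i. (z (1 + i))\<^sup>2) (n - 1) \<le> ?r\<^sup>2"
    by (rule e1_sq_le_square) (use z in auto)
  ultimately have "e1 (\<lambda>i. (z i)\<^sup>2) n \<le> (1 / (v + 1))\<^sup>2 + (2 / ((v - 1) * (v + 1)))\<^sup>2"
    using split[of "\<lambda>i. (z i)\<^sup>2"] z1 True by simp
  also have "\<dots> = ((v - 1)\<^sup>2 + 4) / ((v - 1) * (v + 1))\<^sup>2"
    using v by (simp add: divide_simps power_mult_distrib)
  also have "\<dots> \<le> 1 / v\<^sup>2"
  proof -
    \<comment> \<open>The cleared inequality has difference \<open>v^2 * (2 * v - 7) + 1\<close>;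
      this is where \<open>v\<close> must be at least 4.\<close>
    have "0 \<le> v\<^sup>2 * (2 * v - 7)" using v by simp
    then have "((v - 1)\<^sup>2 + 4) * v\<^sup>2 \<le> ((v - 1) * (v + 1))\<^sup>2"
      by (simp add: power2_eq_square algebra_simps)
    then show ?thesis using v by (simp add: divide_simps)
  qed
  finally show ?thesis .
qed

text \<open>The constants are 1 + 1/2 + 1/4 and 1 + 1/2 + 1/4 + 1/15, the targets for the two direct
  estimates.\<close>

lemma e1_vseq_ge: "3 \<le> n \<Longrightarrow> 7 / 4 \<le> e1 (recip vseq) n"
  "4 \<le> n \<Longrightarrow> 109 / 60 \<le> e1 (recip vseq) n"
proof -
  have a: "e1 (recip vseq) 3 = 7/4" "e1 (recip vseq) 4 = 109 / 60"
    using vseq_values by (simp_all add: numeral_eq_Suc recip_def del: vseq.simps(4))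
  have b: "e1 (recip vseq) m \<le> e1 (recip vseq) n" if "m \<le> n" for m n
    by (rule e1_mono_length) (use recip_vseq_pos that in \<open>auto simp: less_imp_le\<close>)
  show "3 \<le> n \<Longrightarrow> 7 / 4 \<le> e1 (recip vseq) n" using a b[of 3 n] by simp
  show "4 \<le> n \<Longrightarrow> 109 / 60 \<le> e1 (recip vseq) n" using a b[of 4 n] by simp
qed

context sorted_ints
begin

text \<open>All reciprocals are at most 1/2, so \<open>e1_square\<close> gives a quadratic
  inequality for \<open>?S\<close>; for \<open>n\<close> below 3 counting terms is enough.\<close>

lemma e1_le_vseq_first:
  assumes E: "e2 (recip x) n < 1" and n: "1 \<le> n" and x1: "x 1 \<noteq> 1"
  shows "e1 (recip x) n \<le> e1 (recip vseq) n"
proof -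
  let ?S = "e1 (recip x) n"
  have "1 + 1 \<le> x 1" using ge_1[of 1] int_pos[of 1] n x1 by (intro Ints_gap) auto
  then have y1: "recip x 1 \<le> 1 / 2" by (simp add: recip_def frac_le)
  have y: "0 \<le> recip x i \<and> recip x i \<le> 1 / 2" if "1 \<le> i" "i \<le> n" for i
    using recip_pos[OF that] recip_mono[of 1 i] that y1 by auto
  have le: "?S \<le> real n * (1 / 2)" by (rule e1_le_mult) (use y in auto)
  consider "n = 1" | "n = 2" | "3 \<le> n" using n by linarith
  then show ?thesis
  proof cases
    case 3
    have "e1 (\<lambda>i. (recip x i)\<^sup>2) n \<le> 1 / 2 * ?S" by (rule e1_sq_le_mult) (use y in auto)
    then have "?S\<^sup>2 - ?S / 2 \<le> 2" using e1_square[of "recip x" n] E by simp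
    \<comment> \<open>The product equals \<open>?S^2 - ?S / 2 - 35 / 16\<close>, and 35/16 exceeds
      2.\<close>
    moreover have "0 \<le> (?S - 7 / 4) * (?S + 5 / 4)" if "7 / 4 \<le> ?S"
      using that by (intro mult_nonneg_nonneg) auto
    ultimately have "?S \<le> 7 / 4" by (auto simp: power2_eq_square algebra_simps intro: leI)
    then show ?thesis using e1_vseq_ge(1)[OF 3] by simp
  qed (use le in \<open>simp_all add: recip_def numeral_2_eq_2\<close>)
qed

text \<open>After the leading 1 all reciprocals are at most 1/3, and the tail satisfies
  \<open>?s + e2 ?z (n - 1) < 1\<close>; the same quadratic method applies to
  \<open>?s\<close>.\<close>

lemma e1_le_vseq_second:
  assumes E: "e2 (recip x) n < 1" and n: "2 \<le> n" and x1: "x 1 = 1" and x2: "2 < x 2"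
  shows "e1 (recip x) n \<le> e1 (recip vseq) n"
proof -
  let ?z = "\<lambda>i. recip x (1 + i)"
  let ?s = "e1 ?z (n - 1)"
  have S: "e1 (recip x) n = 1 + ?s"
    using e1_add[of "recip x" 1 "n - 1"] n x1 by (simp add: recip_def)
  have "2 + 1 \<le> x 2" using int_pos[of 2] n x2 by (intro Ints_gap) auto
  then have y2: "recip x 2 \<le> 1 / 3" by (simp add: recip_def frac_le)
  have y: "0 \<le> ?z i \<and> ?z i \<le> 1 / 3" if "1 \<le> i" "i \<le> n - 1" for i
  proof -
    have "1 + i \<le> n" "2 \<le> 1 + i" using that n by auto
    then show ?thesis using recip_pos[of "1 + i"] recip_mono[of 2 "1 + i"] y2 by linarith
  qed
  have le: "?s \<le> real (n - 1) * (1 / 3)" by (rule e1_le_mult) (use y in auto)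
  consider "n = 2" | "n = 3" | "4 \<le> n" using n by linarith
  then show ?thesis
  proof cases
    case 1
    then show ?thesis using le S by (simp add: recip_def numeral_2_eq_2)
  next
    case 2
    then show ?thesis using le S e1_vseq_ge(1)[of n] by simp
  next
    case 3
    have "e1 (\<lambda>i. (?z i)\<^sup>2) (n - 1) \<le> 1 / 3 * ?s" by (rule e1_sq_le_mult) (use y in auto)
    moreover have "?s + e2 ?z (n - 1) < 1"
      using E e2_add[of "recip x" 1 "n - 1"] n x1 by (simp add: recip_def)
    ultimately have "?s\<^sup>2 + 5 / 3 * ?s < 2" using e1_square[of ?z "n - 1"] by simp
    \<comment> \<open>49/60 is 109/60 without the leading 1; at this value the quadratic already
      exceeds 2.\<close>
    moreover have "(49 / 60)\<^sup>2 \<le> ?s\<^sup>2" if "49 / 60 \<le> ?s"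
      using that by (intro power_mono) auto
    ultimately have "?s \<le> 49 / 60" by (auto simp: power2_eq_square intro: leI)
    then show ?thesis using e1_vseq_ge(2)[OF 3] S by simp
  qed
qed

lemma e1_le_vseq:
  assumes E: "e2 (recip x) n < 1" and Ev: "e2 (recip x) n \<le> e2 (recip vseq) n"
  shows "e1 (recip x) n \<le> e1 (recip vseq) n"
proof (cases "\<forall>i. 1 \<le> i \<and> i \<le> n \<longrightarrow> x i = vseq i")
  case True
  have "e1 (recip x) n = e1 (recip vseq) n"
    by (rule e1_cong) (use True in \<open>auto simp: recip_def\<close>)
  then show ?thesis by simp
next
  case False
  define i where "i = (LEAST i. 1 \<le> i \<and> i \<le> n \<and> x i \<noteq> vseq i)"
  have i: "1 \<le> i" "i \<le> n" "x i \<noteq> vseq i"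
    using False LeastI_ex[of "\<lambda>i. 1 \<le> i \<and> i \<le> n \<and> x i \<noteq> vseq i"] unfolding i_def by auto
  have eq: "x l = vseq l" if "1 \<le> l" "l < i" for l
    using not_less_Least[of l "\<lambda>i. 1 \<le> i \<and> i \<le> n \<and> x i \<noteq> vseq i"] that i unfolding i_def
    by auto
  define j where "j = i - 1"
  have j: "i = Suc j" "j < n" using i by (auto simp: j_def)
  define z where "z = (\<lambda>i. recip x (j + i))"
  define m where "m = n - j"
  have n: "n = j + m" "1 \<le> m" using j by (auto simp: m_def)
  have pre: "e1 (recip x) j = e1 (recip vseq) j" "e2 (recip x) j = e2 (recip vseq) j"
    "e1 (\<lambda>i. (recip x i)\<^sup>2) j = e1 (\<lambda>i. (recip vseq i)\<^sup>2) j"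
    using eq j by (auto intro!: e1_cong e2_cong simp: recip_def)
  have zpos: "0 \<le> z i \<and> z i \<le> z 1" if "1 \<le> i" "i \<le> m" for i
    using recip_pos[of "j + i"] recip_mono[of "j + 1" "j + i"] that n
    by (auto simp: z_def less_imp_le)
  show ?thesis
  proof (cases "j = 0")
    case True
    then show ?thesis using e1_le_vseq_first[OF E] i j by simp
  next
    case False
    let ?S = "e1 (recip vseq) j" and ?v = "vseq i"
    have v: "?v - 1 = ?S * pr vseq j" using j vseq_Suc by simp
    have S: "0 < ?S" by (rule e1_pos) (use recip_vseq_pos False in auto)
    have v1: "0 < ?v - 1" using v S vseq_pr_pos[of j] by simp
    have "e2 (recip vseq) j + ?S * e1 z m + e2 z m < 1"
      using E e2_add[of "recip x" j m] pre n by (simp add: z_def)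
    moreover have "0 \<le> e2 z m" by (rule e2_nonneg) (use zpos in auto)
    \<comment> \<open>The prefix agrees with \<open>vseq\<close>, so the room left below 1 is
      \<open>1 / pr vseq j\<close>. Dividing by \<open>?S\<close> turns it into
      \<open>1 / (?v - 1)\<close>.\<close>
    ultimately have "?S * e1 z m < 1 / pr vseq j" using e2_vseq[of j] by simp
    then have "e1 z m * ?S < 1 / pr vseq j" by (simp only: mult.commute)
    then have "e1 z m < 1 / pr vseq j / ?S" using S by (simp only: pos_less_divide_eq)
    then have t: "e1 z m < 1 / (?v - 1)" using v by (simp add: mult.commute)
    have "z 1 \<le> e1 z m"
      using e1_mono_length[of 1 m z] zpos n(2) by simp
    then have "1 / x i < 1 / (?v - 1)" using t j by (simp add: z_def recip_def)
    then have "?v - 1 < x i" using v1 int_pos[of i] i by (simp add: divide_simps split: if_splits)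
    \<comment> \<open>Integrality gives \<open>?v \<le> x i\<close>, and equality is excluded by the
      choice of \<open>i\<close>.\<close>
    then have "?v - 1 + 1 \<le> x i" using int_pos[of i] i vseq_Ints by (intro Ints_gap) auto
    then have xi: "?v < x i" using i by simp
    show ?thesis
    proof (cases "j = 1")
      case True
      then show ?thesis
        using e1_le_vseq_second[OF E] xi eq[of 1] j by (simp add: numeral_2_eq_2)
    next
      case j2: False
      have "e1 (\<lambda>i. (z i)\<^sup>2) m \<le> 1 / ?v\<^sup>2"
      proof (rule tail_squares_le)
        show "4 \<le> ?v" using vseq_ge_4[of i] j False j2 by simp
        show "z 1 = 1 / x i" using j by (simp add: z_def recip_def)
      qed (use zpos n vseq_Ints int_pos[of i] i xi t in auto)
      \<comment> \<open>The first term of the \<open>vseq\<close> tail alone outweighs all squares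
        in the tail of \<open>x\<close>.\<close>
      also have "1 / ?v\<^sup>2 \<le> e1 (\<lambda>i. (recip vseq (j + i))\<^sup>2) m"
        using e1_mono_length[of 1 m "\<lambda>i. (recip vseq (j + i))\<^sup>2"] n j
        by (simp add: recip_def power_divide)
      finally have "e1 (\<lambda>i. (recip x i)\<^sup>2) n \<le> e1 (\<lambda>i. (recip vseq i)\<^sup>2) n"
        unfolding n e1_add z_def using pre by simp
      then have "(e1 (recip x) n)\<^sup>2 \<le> (e1 (recip vseq) n)\<^sup>2"
        using Ev by (simp add: e1_square)
      then show ?thesis
        by (rule power2_le_imp_le) (use recip_vseq_pos in \<open>auto intro!: e1_nonneg simp: less_imp_le\<close>)
    qed
  qed
qed

end

section \<open>The bound on \<open>e2\<close>\<close>

lemma e1_ln_recip: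
  assumes "\<And>i. 1 \<le> i \<Longrightarrow> i \<le> n \<Longrightarrow> 0 < x i \<and> 0 < v i"
  shows "e1 (\<lambda>i. ln (recip v i / recip x i)) n = ln (pr x n / pr v n)"
  using assms
proof (induction n)
  case (Suc n)
  have p: "0 < pr x n" "0 < pr v n" by (rule prod_pos; use Suc.prems in auto)+
  have q: "0 < x (Suc n)" "0 < v (Suc n)" using Suc.prems[of "Suc n"] by auto
  have "pr x (Suc n) / pr v (Suc n) = (pr x n / pr v n) * (recip v (Suc n) / recip x (Suc n))"
    by (simp add: recip_def)
  moreover have "ln \<dots> = ln (pr x n / pr v n) + ln (recip v (Suc n) / recip x (Suc n))"
    by (rule ln_mult_pos) (use p q in \<open>auto simp: recip_def\<close>)
  moreover have "e1 (\<lambda>i. ln (recip v i / recip x i)) n = ln (pr x n / pr v n)"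
    using Suc by simp
  ultimately show ?case by simp
qed simp

lemma e2_le_vseq:
  assumes "sorted_ints x n" "e2 (recip x) n < 1"
  shows "e2 (recip x) n \<le> e2 (recip vseq) n"
  using assms
proof (induction n rule: less_induct)
  case (less n)
  interpret sorted_ints x n by fact
  let ?l = "\<lambda>i. ln (recip vseq i / recip x i)"
  show ?case
  proof (cases "pr x n \<le> pr vseq n")
    case True
    have "e2 (recip x) n \<le> 1 - 1 / pr x n" by (rule e2_gap) (use int_pos less.prems in auto)
    also have "\<dots> \<le> 1 - 1 / pr vseq n"
      using True pr_pos[of n] by (simp add: frac_le)
    also have "\<dots> = e2 (recip vseq) n" using e2_vseq[of n] by simp
    finally show ?thesis .
  next
    case False
    have n0: "0 < e1 ?l n"
    proof -
      have "1 < pr x n / pr vseq n" using False vseq_pr_pos[of n] by simp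
      then have "0 < ln (pr x n / pr vseq n)" by (rule ln_gt_zero)
      then show ?thesis using e1_ln_recip[of n x vseq] int_pos vseq_ge_1 by force
    qed
    obtain k where k: "k \<le> n" and kmin: "\<And>j. j \<le> n \<Longrightarrow> e1 ?l k \<le> e1 ?l j"
    proof -
      have "Min (e1 ?l ` {..n}) \<in> e1 ?l ` {..n}" by (rule Min_in) auto
      then obtain k where "k \<in> {..n}" "Min (e1 ?l ` {..n}) = e1 ?l k" by (rule imageE)
      moreover have "Min (e1 ?l ` {..n}) \<le> e1 ?l j" if "j \<le> n" for j
        using that by (intro Min_le) auto
      ultimately show thesis using that[of k] by simp
    qed
    \<comment> \<open>The empty prefix has logarithmic sum 0 while the full one is positive, so the
      minimum is not at \<open>n\<close>; \<open>k = 0\<close> is allowed.\<close>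
    have kn: "k < n" using kmin[of 0] n0 k by (cases "k = n") auto
    interpret P: sorted_ints x k by (rule prefix) (use k in simp)
    define m where "m = n - k"
    have n: "n = k + m" using k by (simp add: m_def)
    have Ek: "e2 (recip x) k < 1" using e2_prefix_le[OF k] less.prems by simp
    have A: "e2 (recip x) k \<le> e2 (recip vseq) k"
      by (rule less.IH[OF kn]) (use P.sorted_ints_axioms Ek in auto)
    have C: "e1 (recip x) k \<le> e1 (recip vseq) k" by (rule P.e1_le_vseq[OF Ek A])
    let ?y = "\<lambda>i. recip x (k + i)" and ?w = "\<lambda>i. recip vseq (k + i)"
    \<comment> \<open>The weight is the prefix sum of \<open>x\<close>, so that the cross term of
      \<open>e2_add\<close> is included. Minimality of \<open>k\<close> supplies the majorization of
      the tails.\<close>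
    have "e1 (recip x) k * e1 ?y m + e2 ?y m \<le> e1 (recip x) k * e1 ?w m + e2 ?w m"
    proof (rule e1_e2_majorization)
      show "0 \<le> e1 (\<lambda>i. ln (?w i / ?y i)) j" if "j \<le> m" for j
        using kmin[of "k + j"] that n e1_add[of ?l k j] by simp
      show "0 \<le> e1 (recip x) k" by (rule e1_nonneg) (use P.recip_pos in \<open>auto simp: less_imp_le\<close>)
    qed (use n recip_pos recip_vseq_pos recip_mono in auto)
    also have "\<dots> \<le> e1 (recip vseq) k * e1 ?w m + e2 ?w m"
      by (intro add_right_mono mult_right_mono C e1_nonneg) (use recip_vseq_pos in \<open>auto simp: less_imp_le\<close>)
    finally show ?thesis using A by (simp add: n e2_add)
  qed
qed

section \<open>The bound on a single entry\<close>

lemma sorted_ints_bound: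
  assumes "sorted_ints x n" "e2 (recip x) n = 1" "m < n"
  shows "x (Suc m) \<le> 2 * real (n - m) * vseq (Suc m)"
proof (rule ccontr)
  interpret sorted_ints x n by fact
  interpret P: sorted_ints x m by (rule prefix) (use assms in simp)
  let ?E = "e2 (recip x) m" and ?S = "e1 (recip x) m" and ?v = "vseq (Suc m)"
  let ?z = "\<lambda>i. recip x (m + i)"
  let ?t = "e1 ?z (n - m)"
  assume "\<not> ?thesis"
  then have X: "2 * real (n - m) * ?v < x (Suc m)" by simp
  have v: "1 \<le> ?v" by (rule vseq_ge_1) simp
  have t: "?t \<le> real (n - m) * recip x (Suc m)"
    by (rule e1_le_mult) (use recip_mono assms in auto)
  have "real (n - m) * recip x (Suc m) < 1 / (2 * ?v)"
    using X v int_pos[of "Suc m"] assms(3) by (simp add: recip_def field_simps del: vseq.simps)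
  then have t: "?t < 1 / (2 * ?v)" using t by simp
  have S0: "0 \<le> ?S" by (rule e1_nonneg) (use P.recip_pos in \<open>auto simp: less_imp_le\<close>)
  have zpos: "0 < ?z i" if "1 \<le> i" "i \<le> n - m" for i
    using recip_pos[of "m + i"] that by simp
  have t0: "0 \<le> ?t" by (rule e1_nonneg) (use zpos in \<open>auto simp: less_imp_le\<close>)
  have "0 < ?t"
    by (rule e1_pos) (use zpos assms(3) in auto)
  have sum: "?E + ?S * ?t + e2 ?z (n - m) = 1"
    using assms e2_add[of "recip x" m "n - m"] by simp
  have e2z: "0 \<le> e2 ?z (n - m)" by (rule e2_nonneg) (use zpos in \<open>auto simp: less_imp_le\<close>)
  have "e1 (\<lambda>i. (?z i)\<^sup>2) (n - m) \<ge> 0" by (rule e1_nonneg) simp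
  then have "2 * e2 ?z (n - m) \<le> ?t\<^sup>2" using e1_square[of ?z "n - m"] by simp
  then have up: "1 - ?E \<le> ?S * ?t + ?t\<^sup>2 / 2" using sum by simp
  \<comment> \<open>A nonempty prefix meets the nonempty tail in a positive cross term; for
    \<open>m = 0\<close> the sum \<open>?E\<close> is 0.\<close>
  have E1: "?E < 1"
  proof (cases "m = 0")
    case False
    have "0 < ?S" by (rule e1_pos) (use P.recip_pos False in auto)
    then have "0 < ?S * ?t" using \<open>0 < ?t\<close> by simp
    then show ?thesis using sum e2z by linarith
  qed simp
  have A: "?E \<le> e2 (recip vseq) m" by (rule e2_le_vseq[OF P.sorted_ints_axioms E1])
  have C: "?S \<le> e1 (recip vseq) m" by (rule P.e1_le_vseq[OF E1 A])
  have "?S / ?v \<le> 1 - ?E"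
  proof -
    let ?p = "pr vseq m"
    have p: "0 < ?p" by (rule vseq_pr_pos)
    \<comment> \<open>Indeed \<open>?S * ?p\<close> is at most
      \<open>e1 (recip vseq) m * ?p\<close>, which is \<open>?v - 1\<close>.\<close>
    have "?S * ?p \<le> ?v"
      using C p by (simp add: vseq_Suc mult_right_mono add_increasing del: vseq.simps)
    then have "?S / ?v \<le> 1 / ?p" using p v by (simp add: divide_simps mult.commute)
    also have "\<dots> \<le> 1 - ?E" using A e2_vseq[of m] by simp
    finally show ?thesis .
  qed
  moreover have t2: "?t\<^sup>2 \<le> (1 / (2 * ?v))\<^sup>2" using t t0 by (intro power_mono) auto
  moreover have St: "?S * ?t \<le> ?S * (1 / (2 * ?v))" using t S0 by (intro mult_left_mono) auto
  ultimately have "?S / ?v \<le> ?S * (1 / (2 * ?v)) + (1 / (2 * ?v))\<^sup>2 / 2" using up by linarith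
  \<comment> \<open>Half of \<open>?S / ?v\<close> is absorbed on the left, leaving
    \<open>?S / (2 * ?v)\<close> bounded by \<open>1 / (8 * ?v^2)\<close>.\<close>
  then have "?S \<le> 1 / (4 * ?v)" using v by (simp add: field_simps power2_eq_square del: vseq.simps)
  also have "\<dots> \<le> 1 / 4" using v by (simp add: frac_le)
  finally have S: "?S \<le> 1 / 4" .
  have "1 / (2 * ?v) \<le> 1 / 2" using v by (simp add: frac_le)
  then have t': "?t \<le> 1 / 2" using t by simp
  \<comment> \<open>With \<open>?S\<close> this small, \<open>1 - ?E\<close> is at least 31/32,
    while the right side of \<open>up\<close> is at most 1/4.\<close>
  have "?S * ?t \<le> 1 / 4 * (1 / 2)" using S t' S0 t0 by (intro mult_mono) auto
  moreover have "?t\<^sup>2 \<le> (1 / 2)\<^sup>2" using t' t0 by (intro power_mono) auto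
  moreover have "?S\<^sup>2 \<le> (1 / 4)\<^sup>2" using S S0 by (intro power_mono) auto
  moreover have "2 * ?E \<le> ?S\<^sup>2"
  proof -
    have "e1 (\<lambda>i. (recip x i)\<^sup>2) m \<ge> 0" by (rule e1_nonneg) simp
    then show ?thesis using e1_square[of "recip x" m] by simp
  qed
  ultimately show False using up by (simp add: power2_eq_square)
qed

section \<open>From \<open>esym\<close> to sums of reciprocals\<close>

lemma esym_0: "esym 0 n x = 1"
proof -
  have "{S. S \<subseteq> {1..n} \<and> card S = 0} = {{}}" by (auto dest: finite_subset)
  then show ?thesis by (simp add: esym_def)
qed

text \<open>The subsets are split by whether they contain \<open>Suc n\<close>; removing it is a
  bijection onto the subsets of size \<open>j\<close> of the shorter range.\<close>

lemma esym_Suc: "esym (Suc j) (Suc n) x = esym (Suc j) n x + x (Suc n) * esym j n x"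
proof -
  let ?A = "\<lambda>j (n::nat). {S. S \<subseteq> {1..n} \<and> card S = j}"
  have fin: "finite (?A j n)" for j n by (rule finite_subset[of _ "Pow {1..n}"]) auto
  have f: "finite S" "Suc n \<notin> S" if "S \<subseteq> {1..n}" for S
    using that by (auto intro: finite_subset)
  have eq: "?A (Suc j) (Suc n) = ?A (Suc j) n \<union> insert (Suc n) ` ?A j n"
  proof (intro equalityI subsetI)
    fix S assume S: "S \<in> ?A (Suc j) (Suc n)"
    show "S \<in> ?A (Suc j) n \<union> insert (Suc n) ` ?A j n"
    proof (cases "Suc n \<in> S")
      case True
      then have "S = insert (Suc n) (S - {Suc n})" by auto
      moreover have "S - {Suc n} \<in> ?A j n"
        using S True by (auto simp: le_Suc_eq)
      ultimately show ?thesis by blast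
    next
      case False
      then show ?thesis using S by (auto simp: le_Suc_eq)
    qed
  next
    fix S assume "S \<in> ?A (Suc j) n \<union> insert (Suc n) ` ?A j n"
    then show "S \<in> ?A (Suc j) (Suc n)" using f by force
  qed
  have "(\<Sum>S\<in>?A (Suc j) (Suc n). prod x S)
      = (\<Sum>S\<in>?A (Suc j) n. prod x S) + (\<Sum>S\<in>insert (Suc n) ` ?A j n. prod x S)"
    unfolding eq by (rule sum.union_disjoint) (use f(2) fin in auto)
  also have "(\<Sum>S\<in>insert (Suc n) ` ?A j n. prod x S) = (\<Sum>S\<in>?A j n. prod x (insert (Suc n) S))"
  proof -
    have "inj_on (insert (Suc n)) (?A j n)"
    proof (rule inj_onI)
      fix S T assume "S \<in> ?A j n" "T \<in> ?A j n" "insert (Suc n) S = insert (Suc n) T"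
      then show "S = T" using f(2)[of S] f(2)[of T] insert_ident[of "Suc n" S T] by simp
    qed
    then show ?thesis by (subst sum.reindex) (simp_all only: o_def)
  qed
  also have "\<dots> = (\<Sum>S\<in>?A j n. x (Suc n) * prod x S)"
  proof (rule sum.cong[OF refl])
    fix S assume "S \<in> ?A j n"
    then show "prod x (insert (Suc n) S) = x (Suc n) * prod x S" using f[of S] by simp
  qed
  finally show ?thesis by (simp add: esym_def sum_distrib_left)
qed

lemma esym_gt:
  assumes "n < j"
  shows "esym j n x = 0"
proof -
  from assms have "card S \<noteq> j" if "S \<subseteq> {1..n}" for S
    using card_mono[OF _ that] by simp
  then have "{S. S \<subseteq> {1..n} \<and> card S = j} = {}" by blast
  then show ?thesis by (simp only: esym_def sum.empty)
qed

lemma esym_top: "esym n n x = (\<Prod>i\<in>{1..n}. x i)"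
  by (induction n) (simp_all add: esym_0 esym_Suc esym_gt mult.commute)

text \<open>\<open>esym_Suc\<close> and \<open>pr_e_Suc\<close> express the same recurrence, with
  \<open>esym_top\<close> as the inhomogeneous term.\<close>

lemma esym_top_1:
  assumes "\<And>i. 1 \<le> i \<Longrightarrow> i \<le> Suc n \<Longrightarrow> x i \<noteq> 0"
  shows "esym n (Suc n) x = pr x (Suc n) * e1 (recip x) (Suc n)"
  using assms
proof (induction n)
  case 0
  then show ?case by (simp add: esym_0 recip_def)
next
  case (Suc n)
  have "x (Suc (Suc n)) \<noteq> 0" using Suc.prems by auto
  moreover have "esym n (Suc n) x = pr x (Suc n) * e1 (recip x) (Suc n)"
    using Suc by simp
  ultimately show ?case
    using pr_e_Suc(1)[of x "Suc n"] esym_Suc[of n "Suc n" x] esym_top[of "Suc n" x]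
    by (simp del: e1.simps prod.cl_ivl_Suc)
qed

lemma esym_top_2:
  assumes "\<And>i. 1 \<le> i \<Longrightarrow> i \<le> n + 2 \<Longrightarrow> x i \<noteq> 0"
  shows "esym n (n + 2) x = pr x (n + 2) * e2 (recip x) (n + 2)"
  using assms
proof (induction n)
  case 0
  then show ?case by (simp add: esym_0 recip_def numeral_2_eq_2)
next
  case (Suc n)
  have nz: "x (Suc (n + 2)) \<noteq> 0" using Suc.prems by auto
  have 1: "esym (Suc n) (Suc (Suc n)) x = pr x (n + 2) * e1 (recip x) (n + 2)"
    using esym_top_1[of "Suc n" x] Suc.prems by simp
  have 2: "esym n (n + 2) x = pr x (n + 2) * e2 (recip x) (n + 2)"
    using Suc by simp
  have "esym (Suc n) (Suc (n + 2)) x = esym (Suc n) (n + 2) x + x (Suc (n + 2)) * esym n (n + 2) x"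
    by (rule esym_Suc)
  also have "\<dots> = pr x (n + 2) * e1 (recip x) (n + 2)
      + x (Suc (n + 2)) * (pr x (n + 2) * e2 (recip x) (n + 2))"
    using 1 2 by simp
  also have "\<dots> = pr x (Suc (n + 2)) * e2 (recip x) (Suc (n + 2))"
    using pr_e_Suc(2)[of x "n + 2"] nz by simp
  finally show ?case by simp
qed

lemma of_int_esym: "real_of_int (esym j n x) = esym j n (\<lambda>i. of_int (x i))"
  by (simp add: esym_def)

theorem theorem11:
  fixes n k :: nat and x :: "nat \<Rightarrow> int"
  assumes "n \<ge> 3"
    and "0 < x 1"
    and "\<And>i. 1 \<le> i \<Longrightarrow> i < n \<Longrightarrow> x i \<le> x (i + 1)"
    and "esym (n - 2) n x = esym n n x"
    and "k \<le> n - 1"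
  shows "real_of_int (x (n - k)) \<le> 2 * (real k + 1) * vseq (n - k)"
proof -
  define r where "r = (\<lambda>i. real_of_int (x i))"
  have mono: "x i \<le> x j" if "1 \<le> i" "i \<le> j" "j \<le> n" for i j
    using that(2,1,3)
  proof (induction rule: dec_induct)
    case (step l)
    then show ?case using assms(3)[of l] by simp
  qed simp
  interpret sorted_ints r n
  proof
    show "r i \<in> \<int> \<and> 0 < r i" if "1 \<le> i" "i \<le> n" for i
      using mono[of 1 i] that assms(2) by (simp add: r_def)
  qed (use mono in \<open>simp add: r_def\<close>)
  have "esym (n - 2) n r = esym n n r"
    using arg_cong[OF assms(4), of real_of_int] by (simp add: of_int_esym r_def)
  moreover have "esym (n - 2) (n - 2 + 2) r = pr r (n - 2 + 2) * e2 (recip r) (n - 2 + 2)"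
  proof (rule esym_top_2)
    show "r i \<noteq> 0" if "1 \<le> i" "i \<le> n - 2 + 2" for i
    proof -
      have "i \<le> n" using that(2) assms(1) by simp
      then show ?thesis using int_pos[of i] that(1) by simp
    qed
  qed
  moreover have "n - 2 + 2 = n" using assms(1) by simp
  ultimately have "pr r n * e2 (recip r) n = pr r n" using esym_top[of n r] by metis
  then have E: "e2 (recip r) n = 1"
    using pr_pos[of n] by (metis mult_cancel_left2 less_irrefl le_refl)
  \<comment> \<open>The prefix length \<open>m = n - k - 1\<close> leaves a tail of
    \<open>k + 1\<close> entries, which is the factor in the bound.\<close>
  have "r (Suc (n - k - 1)) \<le> 2 * real (n - (n - k - 1)) * vseq (Suc (n - k - 1))"
    by (rule sorted_ints_bound[OF sorted_ints_axioms E]) (use assms(1) in simp)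
  moreover have "Suc (n - k - 1) = n - k" "n - (n - k - 1) = k + 1" using assms(1,5) by auto
  ultimately show ?thesis by (simp add: r_def add.commute)
qed

end
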